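(* Let $C\subseteq\mathbb{Z}_2^n$ be a $10$-cap of dimension $7$ that has a basis of extended type $7\text{-}5\text{-}(4)$. Then $C$ has a basis of extended type $5\text{-}5\text{-}(2)$.
   Context: Work in $\mathbb{Z}_2^n$. An affine combination of a set is a sum of an odd number of its distinct elements; $\operatorname{aff}(S)$ is the set of all affine combinations of elements of $S$, and the dimension of $S$ is the dimension of the affine flat $\operatorname{aff}(S)$. A basis for $S$ is a subset $B\subseteq S$ that is affinely independent (no element is an affine combination of the others) with $\operatorname{aff}(B)=\operatorname{aff}(S)$; its dependent set is $D=S\setminus B$. For $x\in D$, $B_x$ is the unique subset of $B$ whose elements sum to $x$. A quad is a set of four distinct elements summing to $\mathbf{0}$; a cap is a quad-free subset; a $k$-cap is a cap with $k$ elements. For $D=\{x_1,x_2\}$, a basis $B$ has extended type $n_1\text{-}n_2\text{-}(m)$ if the elements of $D$ can be labeled $x_1,x_2$ so that $|B_{x_1}|=n_1$, $|B_{x_2}|=n_2$ and $|B_{x_1}\cap B_{x_2}|=m$. *)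

theory Defs
  imports "HOL-Analysis.Analysis" "HOL-Library.Z2"
begin

text \<open>The ambient space \<open>\<int>\<^sub>2\<^sup>n\<close> is \<open>bit ^ 'n\<close> with \<open>n = CARD('n)\<close>.\<close>

definition aff :: "(bit ^ 'n) set \<Rightarrow> (bit ^ 'n) set" where
  "aff S = {x. \<exists>T. T \<subseteq> S \<and> odd (card T) \<and> x = \<Sum>T}"

text \<open>The dimension of an affine flat \<open>a + V\<close> is that of the linear space \<open>V\<close>, which is the set
  of all differences of points of the flat.\<close>

definition flat_dim :: "(bit ^ 'n) set \<Rightarrow> nat" where
  "flat_dim F = vec.dim {x - y | x y. x \<in> F \<and> y \<in> F}"

definition affine_dimension :: "(bit ^ 'n) set \<Rightarrow> nat" where
  "affine_dimension S = flat_dim (aff S)"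

definition aff_independent :: "(bit ^ 'n) set \<Rightarrow> bool" where
  "aff_independent B \<longleftrightarrow> (\<forall>x\<in>B. x \<notin> aff (B - {x}))"

definition is_basis :: "(bit ^ 'n) set \<Rightarrow> (bit ^ 'n) set \<Rightarrow> bool" where
  "is_basis B S \<longleftrightarrow> B \<subseteq> S \<and> aff_independent B \<and> aff B = aff S"

text \<open>\<open>basis_rep B x\<close> is the set written \<open>B\<^sub>x\<close>. Its elements form an affine combination, so their
  number is odd; without this requirement the subset would not be unique, as an affinely
  independent set may be linearly dependent (it may contain \<open>0\<close>, for instance).\<close>

definition basis_rep :: "(bit ^ 'n) set \<Rightarrow> bit ^ 'n \<Rightarrow> (bit ^ 'n) set" where
  "basis_rep B x = (THE T. T \<subseteq> B \<and> odd (card T) \<and> \<Sum>T = x)"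

definition is_quad :: "(bit ^ 'n) set \<Rightarrow> bool" where
  "is_quad Q \<longleftrightarrow> card Q = 4 \<and> \<Sum>Q = 0"

definition is_cap :: "(bit ^ 'n) set \<Rightarrow> bool" where
  "is_cap C \<longleftrightarrow> \<not> (\<exists>Q. Q \<subseteq> C \<and> is_quad Q)"

definition k_cap :: "nat \<Rightarrow> (bit ^ 'n) set \<Rightarrow> bool" where
  "k_cap k C \<longleftrightarrow> is_cap C \<and> card C = k"

definition has_extended_type ::
    "(bit ^ 'n) set \<Rightarrow> (bit ^ 'n) set \<Rightarrow> nat \<Rightarrow> nat \<Rightarrow> nat \<Rightarrow> bool" where
  "has_extended_type S B n1 n2 m \<longleftrightarrow>
     (\<exists>x1 x2. x1 \<noteq> x2 \<and> S - B = {x1, x2} \<and>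
        card (basis_rep B x1) = n1 \<and> card (basis_rep B x2) = n2 \<and>
        card (basis_rep B x1 \<inter> basis_rep B x2) = m)"

lemma bitvec_add_self: "x + x = (0 :: bit ^ 'n)"
  by (simp add: vec_eq_iff)

lemma ex1_basis_rep:
  fixes B :: "(bit ^ 'n) set"
  assumes ind: "aff_independent B" and x: "x \<in> aff B"
  shows "\<exists>!T. T \<subseteq> B \<and> odd (card T) \<and> \<Sum>T = x"
proof -
  have "T = U" if T: "T \<subseteq> B" "odd (card T)" "\<Sum>T = x"
    and U: "U \<subseteq> B" "odd (card U)" "\<Sum>U = x" for T U
  proof (rule ccontr)
    assume ne: "T \<noteq> U"
    have fin: "finite T" "finite U" "finite (T - U)" "finite (U - T)" "finite (T \<inter> U)"
      using T(2) U(2) by (auto intro: card_ge_0_finite odd_pos)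
    define D where "D = (T - U) \<union> (U - T)"
    have finD: "finite D" using fin by (simp add: D_def)
    have split: "\<Sum>T = \<Sum>(T - U) + \<Sum>(T \<inter> U)" "\<Sum>U = \<Sum>(U - T) + \<Sum>(T \<inter> U)"
      using sum.Int_Diff[OF fin(1), of "\<lambda>x. x" U] sum.Int_Diff[OF fin(2), of "\<lambda>x. x" T]
      by (simp_all add: Int_commute add.commute)
    have cards: "card T = card (T - U) + card (T \<inter> U)" "card U = card (U - T) + card (T \<inter> U)"
      using card_Diff_subset_Int[of T U] card_Diff_subset_Int[of U T] fin
        card_mono[of T "T \<inter> U"] card_mono[of U "T \<inter> U"]
      by (auto simp: Int_commute)
    have "\<Sum>D = \<Sum>(T - U) + \<Sum>(U - T)"
      unfolding D_def using fin by (intro sum.union_disjoint) auto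
    also have "\<dots> = 0" using split T(3) U(3) by (simp add: bitvec_add_self)
    finally have D0: "\<Sum>D = 0" .
    have "card D = card (T - U) + card (U - T)"
      unfolding D_def using fin by (intro card_Un_disjoint) auto
    then have evD: "even (card D)"
      using cards T(2) U(2) by presburger
    obtain d where d: "d \<in> D" using ne by (auto simp: D_def)
    have "d + \<Sum>(D - {d}) = 0" using D0 finD d by (simp add: sum.remove)
    then have "d = \<Sum>(D - {d})"
      by (metis add_left_cancel bitvec_add_self)
    moreover have "odd (card (D - {d}))"
      using evD d finD by (auto simp: card_gt_0_iff)
    moreover have "D - {d} \<subseteq> B - {d}" "d \<in> B" using T(1) U(1) d by (auto simp: D_def)
    ultimately show False using ind unfolding aff_independent_def aff_def by blast
  qed
  then show ?thesis using x unfolding aff_def by blast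
qed

end

theory Submission
  imports Defs
begin

text \<open>Call a set of even size with sum \<open>0\<close> a dependency; dependencies are closed under symmetric
  difference, and a set is affinely independent iff it contains no nonempty one. If \<open>x\<close> replaces
  some \<open>i \<in> B\<^sub>x\<close> in a basis \<open>B\<close>, the dependency \<open>B\<^sub>x \<union> {x}\<close> now expresses \<open>i\<close>, while for \<open>y\<close> with
  \<open>i \<in> B\<^sub>y\<close> the symmetric difference of \<open>B\<^sub>x \<union> {x}\<close> and \<open>B\<^sub>y \<union> {y}\<close> avoids \<open>i\<close> and expresses \<open>y\<close>.
  Counting elements, exchanging a common element of \<open>B\<^sub>x\<^sub>1\<close> and \<open>B\<^sub>x\<^sub>2\<close> for \<open>x\<^sub>2\<close> turns a basis of
  extended type \<open>7-5-(4)\<close> into one of extended type \<open>5-5-(2)\<close>.\<close>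

instance bit :: finite
proof
  have "(UNIV :: bit set) \<subseteq> {0, 1}"
    by auto
  then show "finite (UNIV :: bit set)"
    by (rule finite_subset) simp
qed

lemma sum_add_sum_eq_sym_diff:
  fixes f :: "'a \<Rightarrow> 'b::comm_monoid_add"
  assumes "finite T" "finite U"
  shows "sum f T + sum f U = sum f (sym_diff T U) + (sum f (T \<inter> U) + sum f (T \<inter> U))"
proof -
  have "sum f T = sum f (T \<inter> U) + sum f (T - U)" "sum f U = sum f (T \<inter> U) + sum f (U - T)"
    using sum.Int_Diff[OF assms(1), of f U] sum.Int_Diff[OF assms(2), of f T]
    by (simp_all add: Int_commute)
  moreover have "sum f (sym_diff T U) = sum f (T - U) + sum f (U - T)"
    using assms by (intro sum.union_disjoint) auto
  ultimately show ?thesis by (simp add: ac_simps)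
qed

lemma even_card_sym_diff:
  assumes "finite T" "finite U"
  shows "even (card (sym_diff T U)) \<longleftrightarrow> even (card T + card U)"
  using sum_add_sum_eq_sym_diff[OF assms, of "\<lambda>_. 1::nat"] by simp

lemma Sum_sym_diff_bitvec:
  fixes T U :: "(bit ^ 'n) set"
  shows "\<Sum>(sym_diff T U) = \<Sum>T + \<Sum>U"
  using sum_add_sum_eq_sym_diff[of T U "\<lambda>x. x"] by (simp add: bitvec_add_self)

lemma bitvec_add_eq_0_iff: "x + y = 0 \<longleftrightarrow> x = (y :: bit ^ 'n)"
  by (metis add_right_cancel bitvec_add_self)

definition dependency :: "(bit ^ 'n) set \<Rightarrow> bool" where
  "dependency E \<longleftrightarrow> even (card E) \<and> \<Sum>E = 0"

lemma dependency_sym_diff: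
  assumes "dependency E" "dependency F"
  shows "dependency (sym_diff E F)"
  using assms by (simp add: dependency_def even_card_sym_diff Sum_sym_diff_bitvec)

lemma dependency_insert_iff:
  assumes "x \<notin> T"
  shows "dependency (insert x T) \<longleftrightarrow> odd (card T) \<and> \<Sum>T = x"
  using assms by (auto simp: dependency_def bitvec_add_eq_0_iff)

lemma mem_aff_iff_dependency:
  assumes "x \<notin> S"
  shows "x \<in> aff S \<longleftrightarrow> (\<exists>T \<subseteq> S. dependency (insert x T))"
proof -
  have "dependency (insert x T) \<longleftrightarrow> odd (card T) \<and> x = \<Sum>T" if "T \<subseteq> S" for T
    using dependency_insert_iff[of x T] assms that by blast
  then show ?thesis unfolding aff_def by blast
qed

lemma subset_aff: "S \<subseteq> aff S"
proof
  fix x assume "x \<in> S"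
  then have "{x} \<subseteq> S \<and> odd (card {x}) \<and> x = \<Sum>{x}" by simp
  then show "x \<in> aff S" unfolding aff_def by blast
qed

lemma aff_independent_iff_dependency:
  "aff_independent B \<longleftrightarrow> (\<forall>E \<subseteq> B. dependency E \<longrightarrow> E = {})"
proof -
  have "aff_independent B \<longleftrightarrow> (\<forall>x\<in>B. \<forall>T \<subseteq> B - {x}. \<not> dependency (insert x T))"
    by (simp add: aff_independent_def mem_aff_iff_dependency)
  also have "\<dots> \<longleftrightarrow> (\<forall>E \<subseteq> B. dependency E \<longrightarrow> E = {})"
  proof (intro iffI allI ballI impI)
    fix E
    assume no_dep: "\<forall>x\<in>B. \<forall>T \<subseteq> B - {x}. \<not> dependency (insert x T)"
      and E: "E \<subseteq> B" "dependency E"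
    have "x \<notin> E" for x
    proof
      assume "x \<in> E"
      then have "x \<in> B" "E - {x} \<subseteq> B - {x}" "insert x (E - {x}) = E" using E(1) by auto
      then show False using no_dep E(2) by metis
    qed
    then show "E = {}" by blast
  qed blast
  finally show ?thesis .
qed

lemma aff_remove_dependent:
  assumes E: "dependency E" "E \<subseteq> S" "i \<in> E"
  shows "aff (S - {i}) = aff S"
proof
  show "aff (S - {i}) \<subseteq> aff S" unfolding aff_def by blast
  show "aff S \<subseteq> aff (S - {i})"
  proof
    fix x assume "x \<in> aff S"
    then obtain T where T: "T \<subseteq> S" "odd (card T)" "x = \<Sum>T" unfolding aff_def by blast
    show "x \<in> aff (S - {i})"
    proof (cases "i \<in> T")
      case True
      then have "sym_diff T E \<subseteq> S - {i}" using T(1) E by blast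
      moreover have "odd (card (sym_diff T E))" "x = \<Sum>(sym_diff T E)"
        using T E(1) by (simp_all add: dependency_def even_card_sym_diff Sum_sym_diff_bitvec)
      ultimately show ?thesis unfolding aff_def by blast
    next
      case False
      then show ?thesis using T unfolding aff_def by blast
    qed
  qed
qed

lemma aff_independent_exchange:
  assumes ind: "aff_independent B" and T: "T \<subseteq> B" and i: "i \<in> T"
    and x: "x \<notin> B" and dep: "dependency (insert x T)"
  shows "aff_independent (insert x (B - {i}))"
proof -
  have none: "E = {}" if "E \<subseteq> B" "dependency E" for E
    using ind that by (simp add: aff_independent_iff_dependency)
  have "E = {}" if E: "E \<subseteq> insert x (B - {i})" "dependency E" for E
  proof (cases "x \<in> E")
    case True
    have "sym_diff E (insert x T) = {}"
      using none[OF _ dependency_sym_diff[OF E(2) dep]] E(1) T True by blast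
    then show ?thesis using E(1) i x T by blast
  next
    case False
    then show ?thesis using none E by blast
  qed
  then show ?thesis by (simp add: aff_independent_iff_dependency)
qed

lemma aff_exchange:
  assumes "T \<subseteq> B" "i \<in> T" "x \<notin> B" "dependency (insert x T)"
  shows "aff (insert x (B - {i})) = aff B"
proof -
  have "insert x (B - {i}) = insert x B - {i}" "insert x B - {x} = B"
    using assms(1-3) by auto
  moreover have "aff (insert x B - {j}) = aff (insert x B)" if "j \<in> insert x T" for j
    using assms(1,4) that by (intro aff_remove_dependent[of "insert x T"]) auto
  ultimately show ?thesis using assms(2) by (metis insertCI)
qed

lemma basis_rep_eq_iff:
  assumes B: "is_basis B C" and x: "x \<in> C - B"
  shows "basis_rep B x = T \<longleftrightarrow> T \<subseteq> B \<and> dependency (insert x T)"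
proof -
  have "aff_independent B" "x \<in> aff B"
    using B x subset_aff[of C] by (auto simp: is_basis_def)
  then have "basis_rep B x = T \<longleftrightarrow> T \<subseteq> B \<and> odd (card T) \<and> \<Sum>T = x"
    unfolding basis_rep_def by (subst eq_commute) (rule theI_unique[OF ex1_basis_rep, symmetric])
  also have "\<dots> \<longleftrightarrow> T \<subseteq> B \<and> dependency (insert x T)"
    using x dependency_insert_iff[of x T] by blast
  finally show ?thesis .
qed

lemma basis_rep_dependency:
  assumes "is_basis B C" "x \<in> C - B"
  shows "basis_rep B x \<subseteq> B" "dependency (insert x (basis_rep B x))"
  using basis_rep_eq_iff[OF assms, of "basis_rep B x"] by simp_all

lemma is_basis_exchange:
  assumes B: "is_basis B C" and x: "x \<in> C - B" and i: "i \<in> basis_rep B x"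
  shows "is_basis (insert x (B - {i})) C"
proof -
  have "x \<notin> B" using x by simp
  note exchange = basis_rep_dependency(1)[OF B x] i \<open>x \<notin> B\<close> basis_rep_dependency(2)[OF B x]
  show ?thesis
    using B x aff_independent_exchange[OF _ exchange] aff_exchange[OF exchange]
    by (auto simp: is_basis_def)
qed

lemma basis_rep_exchange_removed:
  assumes B: "is_basis B C" and x: "x \<in> C - B" and i: "i \<in> basis_rep B x"
  shows "basis_rep (insert x (B - {i})) i = insert x (basis_rep B x - {i})"
proof -
  note rep = basis_rep_dependency[OF B x]
  have "i \<in> C - insert x (B - {i})" using B x i rep(1) by (auto simp: is_basis_def)
  moreover have "insert i (insert x (basis_rep B x - {i})) = insert x (basis_rep B x)"
    using i by auto
  then have "dependency (insert i (insert x (basis_rep B x - {i})))" using rep(2) by simp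
  moreover have "insert x (basis_rep B x - {i}) \<subseteq> insert x (B - {i})" using rep(1) by blast
  ultimately show ?thesis by (simp only: basis_rep_eq_iff[OF is_basis_exchange[OF assms]])
qed

lemma basis_rep_exchange_other:
  assumes B: "is_basis B C" and x: "x \<in> C - B" and i: "i \<in> basis_rep B x"
    and y: "y \<in> C - B" "y \<noteq> x" "i \<in> basis_rep B y"
  shows "basis_rep (insert x (B - {i})) y = insert x (sym_diff (basis_rep B x) (basis_rep B y))"
    (is "_ = insert x ?D")
proof -
  note rep_x = basis_rep_dependency[OF B x] and rep_y = basis_rep_dependency[OF B y(1)]
  have "sym_diff (insert x (basis_rep B x)) (insert y (basis_rep B y)) = insert y (insert x ?D)"
    using rep_x(1) rep_y(1) x y by blast
  then have "dependency (insert y (insert x ?D))"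
    using dependency_sym_diff[OF rep_x(2) rep_y(2)] by simp
  moreover have "insert x ?D \<subseteq> insert x (B - {i})" using rep_x(1) rep_y(1) i y(3) by blast
  moreover have "y \<in> C - insert x (B - {i})" using y by blast
  ultimately show ?thesis by (simp only: basis_rep_eq_iff[OF is_basis_exchange[OF B x i]])
qed

lemma has_extended_type_exchange:
  assumes B: "is_basis B C" and type: "has_extended_type C B n1 n2 m" and "m > 0"
  shows "\<exists>B'. is_basis B' C \<and> has_extended_type C B' n2 ((n1 - m) + (n2 - m) + 1) (n2 - m + 1)"
proof -
  obtain x1 x2 where ne: "x1 \<noteq> x2" and D: "C - B = {x1, x2}"
    and n1: "card (basis_rep B x1) = n1" and n2: "card (basis_rep B x2) = n2"
    and m: "card (basis_rep B x1 \<inter> basis_rep B x2) = m"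
    using type unfolding has_extended_type_def by blast
  define T1 T2 where "T1 = basis_rep B x1" and "T2 = basis_rep B x2"
  have x: "x1 \<in> C - B" "x2 \<in> C - B" using D by auto
  have T: "T1 \<subseteq> B" "T2 \<subseteq> B" using basis_rep_dependency(1)[OF B] x by (simp_all add: T1_def T2_def)
  then have x2: "x2 \<notin> T1" "x2 \<notin> T2" using x by auto
  obtain i where i: "i \<in> T1" "i \<in> T2"
    using m \<open>m > 0\<close> by (fastforce simp: T1_def T2_def card_gt_0_iff)
  define B' where "B' = insert x2 (B - {i})"
  have rep_i: "basis_rep B' i = insert x2 (T2 - {i})"
    using basis_rep_exchange_removed[OF B x(2)] i by (simp add: B'_def T2_def)
  have rep_x1: "basis_rep B' x1 = insert x2 (sym_diff T2 T1)"
    using basis_rep_exchange_other[OF B x(2) _ x(1) ne] i by (simp add: B'_def T1_def T2_def)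
  have cards: "card (T1 - T2) = n1 - m" "card (T2 - T1) = n2 - m"
    using n1 n2 m by (simp_all add: T1_def T2_def card_Diff_subset_Int Int_commute)
  have "card (basis_rep B' i) = n2"
    using card_Suc_Diff1[OF _ i(2)] x2 n2 by (simp add: rep_i T2_def)
  moreover have "card (sym_diff T2 T1) = (n2 - m) + (n1 - m)"
    unfolding cards[symmetric] by (intro card_Un_disjoint) auto
  then have "card (basis_rep B' x1) = (n1 - m) + (n2 - m) + 1"
    using x2 by (simp add: rep_x1)
  moreover have "basis_rep B' i \<inter> basis_rep B' x1 = insert x2 (T2 - T1)"
    using rep_i rep_x1 i by blast
  then have "card (basis_rep B' i \<inter> basis_rep B' x1) = n2 - m + 1"
    using x2 cards by simp
  moreover have "C - B' = {i, x1}" "i \<noteq> x1"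
    using D B T i ne x by (auto simp: B'_def is_basis_def)
  ultimately have "has_extended_type C B' n2 ((n1 - m) + (n2 - m) + 1) (n2 - m + 1)"
    unfolding has_extended_type_def by blast
  moreover have "is_basis B' C"
    using is_basis_exchange[OF B x(2)] i by (simp add: B'_def T2_def)
  ultimately show ?thesis by blast
qed

theorem theorem5p3:
  fixes C :: "(bit ^ 'n) set"
  assumes "k_cap 10 C"
    and "affine_dimension C = 7"
    and "\<exists>B. is_basis B C \<and> has_extended_type C B 7 5 4"
  shows "\<exists>B. is_basis B C \<and> has_extended_type C B 5 5 2"
proof -
  obtain B where "is_basis B C" "has_extended_type C B 7 5 4"
    using assms(3) by blast
  from has_extended_type_exchange[OF this] show ?thesis
    by (simp add: numeral_2_eq_2)
qed

end
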